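(* Let $l,u$ be real numbers with $0\le l<u\le 1$. Then there exists a function $\varphi:\mathbb N\to\mathbb R^+$ decreasing to zero, with $l_\varphi=l$ and $u_\varphi=u$, such that for every irrational real number $\alpha$ with Diophantine type $\beta(\alpha)<\infty$, $$\dim_H\big(E_\varphi(\alpha)\big)=u .$$
   Context: $\|x\|$ denotes the distance from $x\in\mathbb R$ to the nearest integer, $\mathbb N$ is the set of positive integers, $\mathbb R^+$ the set of positive reals, and $\dim_H$ is Hausdorff dimension. "Decreasing" is understood in the weak sense (non-increasing). The Diophantine type of an irrational $\alpha$ is $\beta(\alpha):=\sup\{\theta\ge 1:\liminf_{n\to\infty} n^\theta\|n\alpha\|=0\}\in[1,\infty]$ (equal to $1$ if the set is empty). For $\varphi:\mathbb N\to\mathbb R^+$ decreasing to zero, $$E_\varphi(\alpha):=\{y\in\mathbb R:\ \|n\alpha-y\|<\varphi(n)\text{ for infinitely many } n\in\mathbb N\},$$ $$u_\varphi:=\limsup_{n\to\infty}\frac{\log n}{-\log\varphi(n)},\qquad l_\varphi:=\liminf_{n\to\infty}\frac{\log n}{-\log\varphi(n)}.$$ *)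

theory Defs
  imports "HOL-Analysis.Analysis"
begin

section \<open>Hausdorff dimension\<close>

text \<open>
  The summand \<open>|U|\<^sup>s\<close> of the Hausdorff sums, with the usual conventions \<open>|\<emptyset>|\<^sup>s = 0\<close> and
  \<open>|U|\<^sup>0 = 1\<close> for nonempty \<open>U\<close>; they are spelled out because \<open>0 powr 0 = 0\<close>.
\<close>

definition diam_powr :: "real \<Rightarrow> 'a::metric_space set \<Rightarrow> ennreal" where
  "diam_powr s U =
     (if U = {} then 0 else if s = 0 then 1 else ennreal (diameter U powr s))"

text \<open>Boundedness is required explicitly because \<open>diameter\<close> is unspecified on unbounded sets.\<close>

definition hausdorff_premeasure :: "real \<Rightarrow> real \<Rightarrow> 'a::metric_space set \<Rightarrow> ennreal" where
  "hausdorff_premeasure s \<delta> A =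
     (INF U\<in>{U :: nat \<Rightarrow> 'a set. A \<subseteq> (\<Union>i. U i) \<and> (\<forall>i. bounded (U i) \<and> diameter (U i) \<le> \<delta>)}.
        \<Sum>i. diam_powr s (U i))"

definition hausdorff_measure :: "real \<Rightarrow> 'a::metric_space set \<Rightarrow> ennreal" where
  "hausdorff_measure s A = (SUP \<delta>\<in>{0<..}. hausdorff_premeasure s \<delta> A)"

definition hausdorff_dim :: "'a::metric_space set \<Rightarrow> ereal" where
  "hausdorff_dim A = (INF s\<in>{s. 0 \<le> s \<and> hausdorff_measure s A = 0}. ereal s)"

section \<open>Inhomogeneous Diophantine approximation\<close>

text \<open>
  Functions on the positive integers are modelled by functions on \<open>nat\<close>; their value at \<open>0\<close>
  never matters, since limits ignore it and \<open>E_set\<close> excludes it.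
\<close>

definition dist_int :: "real \<Rightarrow> real" where
  "dist_int x = infdist x \<int>"

text \<open>
  Inserting \<open>1\<close> changes the supremum only when no \<open>\<theta>\<close> qualifies, in which case the type is \<open>1\<close>.
\<close>

definition dioph_type :: "real \<Rightarrow> ereal" where
  "dioph_type \<alpha> = Sup (insert 1 (ereal ` {\<theta>. 1 \<le> \<theta> \<and>
     liminf (\<lambda>n. ereal (real n powr \<theta> * dist_int (real n * \<alpha>))) = 0}))"

definition E_set :: "(nat \<Rightarrow> real) \<Rightarrow> real \<Rightarrow> real set" where
  "E_set \<phi> \<alpha> = {y. infinite {n. 1 \<le> n \<and> dist_int (real n * \<alpha> - y) < \<phi> n}}"

text \<open>
  If \<open>\<phi>\<close> is positive and tends to zero, then \<open>0 < \<phi> n < 1\<close> for all large \<open>n\<close>, so the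
  logarithms and quotients below are eventually the genuine ones.
\<close>

definition upper_order :: "(nat \<Rightarrow> real) \<Rightarrow> ereal" where
  "upper_order \<phi> = limsup (\<lambda>n. ereal (ln (real n) / (- ln (\<phi> n))))"

definition lower_order :: "(nat \<Rightarrow> real) \<Rightarrow> ereal" where
  "lower_order \<phi> = liminf (\<lambda>n. ereal (ln (real n) / (- ln (\<phi> n))))"

end

theory Submission
  imports Defs
begin

text \<open>
  Put \<open>\<kappa> = l / u \<in> [0, 1)\<close> and \<open>\<phi> n = exp (- G (ln n) / u)\<close>, where \<open>G x \<ge> x\<close> is a nondecreasing staircase.
  There are points \<open>a\<^sub>k < b\<^sub>k < a\<^sub>k\<^sub>+\<^sub>1\<close> with \<open>a\<^sub>k / b\<^sub>k \<rightarrow> \<kappa>\<close> and \<open>a\<^sub>k\<^sub>+\<^sub>1 / b\<^sub>k \<rightarrow> \<infinity>\<close>; the function \<open>G\<close>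
  is constantly \<open>b\<^sub>k\<close> on \<open>(a\<^sub>k, b\<^sub>k]\<close> and the identity on \<open>[b\<^sub>k, a\<^sub>k\<^sub>+\<^sub>1]\<close>. Since
  \<open>ln n / - ln (\<phi> n) = u * ln n / G (ln n)\<close>, the upper order is \<open>u\<close> (where \<open>G\<close> is the identity), and
  the lower order is \<open>\<kappa> u = l\<close> (just after \<open>a\<^sub>k\<close>).

  For the upper bound on the dimension, \<open>\<phi> n \<le> n\<^bsup>-1/u\<^esup>\<close>, so \<open>\<Sum>n. \<phi> n\<^bsup>s\<^esup>\<close> converges for \<open>s > u\<close> and
  the covering argument of Borel--Cantelli type applies (\<open>hausdorff_cantelli\<close>).

  For the lower bound, let \<open>\<alpha>\<close> be irrational of finite type. Dirichlet's theorem with bound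
  \<open>N \<approx> exp a\<^sub>k\<^sub>+\<^sub>1 / 2\<close> gives a reduced fraction \<open>h / q\<close> close to \<open>\<alpha>\<close> with \<open>q \<le> N\<close>, and finiteness of the
  type bounds \<open>q\<close> below by a fixed power of \<open>N\<close>. As \<open>a\<^sub>k\<^sub>+\<^sub>1 / b\<^sub>k \<rightarrow> \<infinity>\<close>, both \<open>ln q\<close> and \<open>ln (2 q)\<close>
  lie in \<open>[b\<^sub>k, a\<^sub>k\<^sub>+\<^sub>1]\<close> for large \<open>k\<close> (\<open>denominator_in_power_range\<close>), whence
  \<open>\<phi> n \<ge> \<phi> (2 q) = (2 q)\<^bsup>-1/u\<^esup>\<close> for \<open>q \<le> n < 2 q\<close>. The points \<open>n \<alpha>\<close> with these \<open>n\<close> are \<open>3 / q\<close>-dense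
  modulo 1 (\<open>multiples_dense\<close>). So at arbitrarily small scales every interval of length
  \<open>\<delta> = 3 / q\<close> contains the centre of an interval of length \<open>r = (2 q)\<^bsup>-1/u\<^esup>\<close> of points approximated well by
  some \<open>n \<alpha>\<close>, and \<open>r\<^bsup>s\<^esup> / \<delta> \<rightarrow> \<infinity>\<close> for every \<open>s < u\<close>.

  Such a ubiquity property forces the limsup set to have nonzero \<open>s\<close>-dimensional measure
  (\<open>hausdorff_measure_ubiquitous_nonzero\<close>). In place of a mass distribution on a Cantor set, the proof
  fixes a countable cover with small total weight \<open>\<Sum>i. |U\<^sub>i|\<^bsup>s\<^esup>\<close> and constructs nested intervals inside
  the approximating ones, such that the members of the cover meeting an interval \<open>I\<close> always have
  total weight less than \<open>|I|\<^bsup>s\<^esup> / 16\<close>. The induction step, \<open>light_subinterval\<close>, is a double counting.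
  The common point of the intervals lies in the limsup set but in no member of the cover.
\<close>

section \<open>Hausdorff null sets and dimension\<close>

lemma hausdorff_measure_eq_0I:
  fixes A :: "'a::metric_space set"
  assumes "\<And>\<delta> e. 0 < \<delta> \<Longrightarrow> 0 < e \<Longrightarrow> \<exists>U :: nat \<Rightarrow> 'a set. A \<subseteq> (\<Union>i. U i) \<and>
             (\<forall>i. bounded (U i) \<and> diameter (U i) \<le> \<delta>) \<and> (\<Sum>i. diam_powr s (U i)) \<le> ennreal e"
  shows "hausdorff_measure s A = 0"
proof -
  have "hausdorff_premeasure s \<delta> A \<le> 0" if \<delta>: "0 < \<delta>" for \<delta>
  proof (rule ennreal_le_epsilon)
    fix e :: real assume "0 < e"
    then obtain U :: "nat \<Rightarrow> 'a set" where "A \<subseteq> (\<Union>i. U i)"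
        "\<forall>i. bounded (U i) \<and> diameter (U i) \<le> \<delta>" "(\<Sum>i. diam_powr s (U i)) \<le> ennreal e"
      using assms[OF \<delta>, of e] by blast
    then have "hausdorff_premeasure s \<delta> A \<le> ennreal e"
      unfolding hausdorff_premeasure_def by (intro INF_lower2[of U]) auto
    then show "hausdorff_premeasure s \<delta> A \<le> 0 + ennreal e"
      by simp
  qed
  then show ?thesis
    unfolding hausdorff_measure_def by (simp add: SUP_eq_const)
qed

lemma hausdorff_measure_Union_eq_0:
  fixes A :: "nat \<Rightarrow> 'a::metric_space set"
  assumes null: "\<And>j. hausdorff_measure s (A j) = 0"
  shows "hausdorff_measure s (\<Union>j. A j) = 0"
proof (rule hausdorff_measure_eq_0I)
  fix \<delta> e :: real assume \<delta>: "0 < \<delta>" and e: "0 < e"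
  have "\<exists>U :: nat \<Rightarrow> 'a set. A j \<subseteq> (\<Union>i. U i) \<and> (\<forall>i. bounded (U i) \<and> diameter (U i) \<le> \<delta>) \<and>
      (\<Sum>i. diam_powr s (U i)) < ennreal (e * (1/2) ^ Suc j)" for j
  proof -
    have "hausdorff_premeasure s \<delta> (A j) \<le> hausdorff_measure s (A j)"
      unfolding hausdorff_measure_def using \<delta> by (intro SUP_upper) simp
    then have "hausdorff_premeasure s \<delta> (A j) < ennreal (e * (1/2) ^ Suc j)"
      using null[of j] e by simp
    then show ?thesis
      unfolding hausdorff_premeasure_def INF_less_iff by blast
  qed
  then obtain U where U: "\<And>j. A j \<subseteq> (\<Union>i. U j i)" "\<And>j i. bounded (U j i)"
      "\<And>j i. diameter (U j i) \<le> \<delta>" "\<And>j. (\<Sum>i. diam_powr s (U j i)) < ennreal (e * (1/2) ^ Suc j)"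
    by metis
  define V where "V n = (case prod_decode n of (j, i) \<Rightarrow> U j i)" for n
  have "(\<Sum>n. diam_powr s (V n)) = (\<Sum>n. (\<lambda>(j, i). diam_powr s (U j i)) (prod_decode n))"
    by (simp add: V_def split_def)
  also have "\<dots> = (\<Sum>j. \<Sum>i. diam_powr s (U j i))"
    by (rule suminf_ennreal_2dimen) simp
  also have "\<dots> \<le> (\<Sum>j. ennreal (e * (1/2) ^ Suc j))"
    using U(4) by (intro suminf_le summableI less_imp_le)
  also have "\<dots> = ennreal e"
    using sums_mult[OF power_half_series, of e] e by (intro suminf_ennreal_eq) auto
  finally have "(\<Sum>n. diam_powr s (V n)) \<le> ennreal e" .
  moreover have "(\<Union>j. A j) \<subseteq> (\<Union>n. V n)"
  proof
    fix x assume "x \<in> (\<Union>j. A j)"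
    then obtain j i where "x \<in> U j i"
      using U(1) by blast
    then have "x \<in> V (prod_encode (j, i))"
      by (simp add: V_def)
    then show "x \<in> (\<Union>n. V n)"
      by blast
  qed
  moreover have "bounded (V n) \<and> diameter (V n) \<le> \<delta>" for n
    using U(2,3) by (simp add: V_def split: prod.splits)
  ultimately show "\<exists>V. (\<Union>j. A j) \<subseteq> (\<Union>n. V n) \<and>
             (\<forall>n. bounded (V n) \<and> diameter (V n) \<le> \<delta>) \<and> (\<Sum>n. diam_powr s (V n)) \<le> ennreal e"
    by blast
qed

text \<open>
  The tails of the sequence of intervals are covers of the limsup set whose Hausdorff sums tend to zero.
\<close>

lemma hausdorff_cantelli:
  fixes x :: "nat \<Rightarrow> real"
  assumes s: "0 < s" and r: "\<And>n. 0 < r n" "r \<longlonglongrightarrow> 0" and summ: "summable (\<lambda>n. r n powr s)"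
  shows "hausdorff_measure s {y. infinite {n. \<bar>x n - y\<bar> < r n}} = 0"
proof (rule hausdorff_measure_eq_0I)
  fix \<delta> e :: real assume \<delta>: "0 < \<delta>" and e: "0 < e"
  have "eventually (\<lambda>n. r n < \<delta> / 2) sequentially"
    using order_tendstoD(2)[OF r(2), of "\<delta> / 2"] \<delta> by simp
  then obtain N1 where N1: "r n < \<delta> / 2" if "N1 \<le> n" for n
    unfolding eventually_sequentially by blast
  have summ2: "summable (\<lambda>n. (2 * r n) powr s)"
    using summable_mult[OF summ, of "2 powr s"] r(1) by (simp add: powr_mult less_imp_le)
  obtain N2 where N2: "norm (\<Sum>i. (2 * r (i + n)) powr s) < e" if "N2 \<le> n" for n
    using suminf_exist_split[OF e summ2] by blast
  define N where "N = max N1 N2"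
  define U where "U i = cball (x (i + N)) (r (i + N))" for i
  have diam: "diameter (U i) = 2 * r (i + N)" for i
    using r(1)[of "i + N"] by (simp add: U_def)
  have "(\<Sum>i. diam_powr s (U i)) = (\<Sum>i. ennreal ((2 * r (i + N)) powr s))"
  proof (rule suminf_cong)
    show "diam_powr s (U i) = ennreal ((2 * r (i + N)) powr s)" for i
      using s r(1)[of "i + N"] unfolding diam_powr_def diam by (auto simp: U_def)
  qed
  also have "\<dots> = ennreal (\<Sum>i. (2 * r (i + N)) powr s)"
    using summ2 by (intro suminf_ennreal2) (simp_all add: summable_iff_shift[of "\<lambda>n. (2 * r n) powr s"])
  also have "\<dots> \<le> ennreal e"
    using N2[of N] by (intro ennreal_leI) (auto simp: N_def)
  finally have "(\<Sum>i. diam_powr s (U i)) \<le> ennreal e" .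
  moreover have "{y. infinite {n. \<bar>x n - y\<bar> < r n}} \<subseteq> (\<Union>i. U i)"
  proof
    fix y assume "y \<in> {y. infinite {n. \<bar>x n - y\<bar> < r n}}"
    then obtain n where n: "N < n" "\<bar>x n - y\<bar> < r n"
      unfolding infinite_nat_iff_unbounded by blast
    then have "y \<in> U (n - N)"
      by (simp add: U_def dist_real_def)
    then show "y \<in> (\<Union>i. U i)"
      by blast
  qed
  moreover have "bounded (U i) \<and> diameter (U i) \<le> \<delta>" for i
  proof -
    have "r (i + N) < \<delta> / 2"
      by (rule N1) (simp add: N_def)
    then show ?thesis
      unfolding diam by (simp add: U_def)
  qed
  ultimately show "\<exists>U. {y. infinite {n. \<bar>x n - y\<bar> < r n}} \<subseteq> (\<Union>i. U i) \<and>
      (\<forall>i. bounded (U i) \<and> diameter (U i) \<le> \<delta>) \<and> (\<Sum>i. diam_powr s (U i)) \<le> ennreal e"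
    by blast
qed

lemma hausdorff_null_cover:
  assumes "hausdorff_measure s A = 0" "0 < e"
  obtains U :: "nat \<Rightarrow> 'a::metric_space set"
  where "A \<subseteq> (\<Union>i. U i)" "\<And>i. bounded (U i)" "(\<Sum>i. diam_powr s (U i)) < e"
proof -
  have "hausdorff_premeasure s 1 A \<le> hausdorff_measure s A"
    unfolding hausdorff_measure_def by (rule SUP_upper) simp
  then have "hausdorff_premeasure s 1 A < e"
    using assms by simp
  then show thesis
    using that unfolding hausdorff_premeasure_def INF_less_iff by blast
qed

lemma hausdorff_measure_0_eq_0D:
  assumes "hausdorff_measure 0 A = 0"
  shows "A = {}"
proof -
  obtain U where U: "A \<subseteq> (\<Union>i. U i)" "(\<Sum>i. diam_powr 0 (U i)) < 1"
    by (rule hausdorff_null_cover[OF assms, of 1]) auto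
  have "U i = {}" for i
    using ennreal_suminf_lessD[OF U(2), of i] by (auto simp: diam_powr_def split: if_splits)
  then show ?thesis
    using U(1) by simp
qed

lemma hausdorff_measure_empty: "hausdorff_measure s {} = 0"
  by (rule hausdorff_measure_eq_0I) (auto intro!: exI[of _ "\<lambda>_. {}"] simp: diam_powr_def)

lemma hausdorff_dim_eqI:
  assumes u: "0 < u"
    and null: "\<And>s. u < s \<Longrightarrow> hausdorff_measure s A = 0"
    and nonnull: "\<And>s. 0 < s \<Longrightarrow> s < u \<Longrightarrow> hausdorff_measure s A \<noteq> 0"
  shows "hausdorff_dim A = ereal u"
proof (rule antisym)
  show "hausdorff_dim A \<le> ereal u"
  proof (rule ereal_le_epsilon2)
    fix e :: real assume "0 < e"
    then show "hausdorff_dim A \<le> ereal u + ereal e"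
      unfolding hausdorff_dim_def using u null[of "u + e"] by (intro INF_lower2[of "u + e"]) auto
  qed
  have "u \<le> s" if "0 \<le> s" "hausdorff_measure s A = 0" for s
  proof (rule ccontr)
    assume "\<not> u \<le> s"
    \<comment> \<open>For \<open>s = 0\<close> the measure vanishes only on the empty set, which is null in every dimension.\<close>
    then have "s = 0"
      using nonnull[of s] that by force
    then have "A = {}"
      using that hausdorff_measure_0_eq_0D by blast
    then show False
      using nonnull[of "u / 2"] u by (simp add: hausdorff_measure_empty)
  qed
  then show "ereal u \<le> hausdorff_dim A"
    unfolding hausdorff_dim_def by (intro INF_greatest) auto
qed

section \<open>Ubiquity and nonzero Hausdorff measure\<close>

lemma card_le_spread:
  fixes S :: "nat set" and D :: real
  assumes "finite S" "0 \<le> D"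
    and spread: "\<And>j k. j \<in> S \<Longrightarrow> k \<in> S \<Longrightarrow> j < k \<Longrightarrow> real k - real j \<le> D"
  shows "real (card S) \<le> 1 + D"
proof (cases "S = {}")
  case True
  then show ?thesis using assms by simp
next
  case False
  have sub: "S \<subseteq> {Min S..Max S}"
    using assms(1) by auto
  have le: "Min S \<le> Max S"
    using False assms(1) by simp
  have "card S \<le> Suc (Max S) - Min S"
    using card_mono[OF _ sub] by simp
  then have "real (card S) \<le> 1 + (real (Max S) - real (Min S))"
    using le by linarith
  moreover have "real (Max S) - real (Min S) \<le> D"
    using spread[of "Min S" "Max S"] False assms(1,2) le
    by (cases "Min S = Max S") auto
  ultimately show ?thesis by linarith
qed

text \<open>
  The total weight of those members of the family \<open>U\<close> that meet \<open>I\<close>.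
\<close>

definition load :: "(nat \<Rightarrow> real set) \<Rightarrow> (nat \<Rightarrow> real) \<Rightarrow> real set \<Rightarrow> real" where
  "load U w I = (\<Sum>i. if U i \<inter> I = {} then 0 else w i)"

lemma summable_restrict:
  fixes w :: "nat \<Rightarrow> real"
  assumes "summable w" "\<And>i. 0 \<le> w i"
  shows "summable (\<lambda>i. if P i then 0 else w i)"
  by (rule summable_comparison_test'[OF assms(1), of 0]) (use assms(2) in auto)

lemma weight_le_load:
  assumes "summable w" "\<And>i. 0 \<le> w i" "U i \<inter> I \<noteq> {}"
  shows "w i \<le> load U w I"
  using sum_le_suminf[OF summable_restrict[OF assms(1,2), where P = "\<lambda>i. U i \<inter> I = {}"], of "{i}"]
    assms(2,3) by (auto simp: load_def)

text \<open>
  The induction step of the nested construction. Here \<open>w i\<close> stands for \<open>d\<^sub>i\<^bsup>s\<^esup>\<close>, where \<open>d\<^sub>i\<close> bounds the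
  diameter of \<open>U i\<close>. The interval of length \<open>\<rho>\<close> is divided into \<open>K \<approx> \<rho> / (2 \<delta>)\<close> slots of length
  \<open>2 \<delta>\<close>, and each slot contains a candidate \<open>J k\<close> of length \<open>r\<close> centred in \<open>P\<close>. The candidates are
  separated, so \<open>U i\<close> meets at most \<open>1 + 2 d\<^sub>i / \<delta>\<close> of them. If every candidate carried weight at
  least \<open>c = r\<^bsup>s\<^esup> / 16\<close>, then so would it with all weights truncated at \<open>c\<close>, and summing over
  the candidates would give
  \<open>K c \<le> \<Sum>i. (1 + 2 d\<^sub>i / \<delta>) min (w i) c\<close>, the sum being over the \<open>i\<close> for which \<open>U i\<close> meets the large interval. The
  lightness of that interval and \<open>d\<^sub>i \<le> w\<^sub>i \<rho>\<^bsup>1-s\<^esup>\<close> make the right-hand side too small.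
\<close>

lemma light_subinterval:
  fixes U :: "nat \<Rightarrow> real set"
  assumes s: "0 < s" "s < 1" and wpos: "\<And>i. 0 < w i" and summ: "summable w"
    and diam: "\<And>i x y. x \<in> U i \<Longrightarrow> y \<in> U i \<Longrightarrow> \<bar>x - y\<bar> powr s \<le> w i"
    and light: "load U w {a..a + \<rho>} < \<rho> powr s / 16"
    and r: "0 < r" "r \<le> \<delta> / 2" and \<delta>: "4 * \<delta> \<le> \<rho>"
    and fine: "8 * \<delta> * \<rho> powr s \<le> \<rho> * r powr s"
    and dense: "\<And>x. \<exists>p\<in>P. x \<le> p \<and> p \<le> x + \<delta>"
  shows "\<exists>p\<in>P. {p - r/2..p + r/2} \<subseteq> {a..a + \<rho>} \<and>
           load U w {p - r/2..p + r/2} < r powr s / 16"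
proof (rule ccontr)
  assume neg: "\<not> ?thesis"
  have \<delta>0: "0 < \<delta>" and \<rho>0: "0 < \<rho>"
    using r \<delta> by auto
  have w0: "0 \<le> w i" for i
    using wpos[of i] by simp
  define K where "K = nat \<lfloor>\<rho> / (2 * \<delta>)\<rfloor>"
  have "real K = of_int \<lfloor>\<rho> / (2 * \<delta>)\<rfloor>"
    using \<delta>0 \<rho>0 by (simp add: K_def)
  then have K1: "real K \<le> \<rho> / (2 * \<delta>)" and K2: "\<rho> / (2 * \<delta>) - 1 < real K"
    by linarith+
  have K_up: "2 * \<delta> * real K \<le> \<rho>"
    using K1 \<delta>0 by (simp add: field_simps)
  have K_low: "\<rho> / (4 * \<delta>) \<le> real K"
  proof -
    have "1 \<le> \<rho> / (4 * \<delta>)"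
      using \<delta>0 \<delta> by simp
    moreover have "\<rho> / (2 * \<delta>) = 2 * (\<rho> / (4 * \<delta>))"
      by simp
    ultimately show ?thesis
      using K2 by linarith
  qed
  \<comment> \<open>The centre is sought in the middle half of the slot, which keeps \<open>J k\<close> inside the slot.\<close>
  have "\<forall>k. \<exists>p\<in>P. a + 2 * \<delta> * real k + \<delta> / 2 \<le> p \<and> p \<le> a + 2 * \<delta> * real k + \<delta> / 2 + \<delta>"
    using dense by blast
  then obtain p where p: "\<And>k. p k \<in> P" "\<And>k. a + 2 * \<delta> * real k + \<delta> / 2 \<le> p k"
      "\<And>k. p k \<le> a + 2 * \<delta> * real k + \<delta> / 2 + \<delta>"
    by metis
  define J where "J k = {p k - r/2..p k + r/2}" for k
  define c where "c = r powr s / 16"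
  have c0: "0 < c"
    using r by (simp add: c_def)
  have J_sub: "J k \<subseteq> {a..a + \<rho>}" if "k < K" for k
  proof -
    have "2 * \<delta> * (real k + 1) \<le> 2 * \<delta> * real K"
      using that \<delta>0 by (intro mult_left_mono) auto
    then have "2 * \<delta> * real k + 2 * \<delta> \<le> \<rho>"
      using K_up by (simp add: algebra_simps)
    moreover have "0 \<le> 2 * \<delta> * real k"
      using \<delta>0 by simp
    ultimately have "a \<le> p k - r/2" "p k + r/2 \<le> a + \<rho>"
      using p(2,3)[of k] r \<delta>0 by linarith+
    then show ?thesis
      unfolding J_def by auto
  qed
  have heavy: "c \<le> load U w (J k)" if "k < K" for k
    using neg p(1)[of k] J_sub[OF that] unfolding J_def c_def by (meson not_le)
  define d where "d i = w i powr (1 / s)" for i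
  have d0: "0 < d i" for i
    using wpos[of i] by (simp add: d_def)
  have wd: "w i = d i powr s" for i
    using wpos[of i] s by (simp add: d_def powr_powr)
  have dist_d: "\<bar>x - y\<bar> \<le> d i" if "x \<in> U i" "y \<in> U i" for i x y
    using diam[OF that] powr_less_mono2[OF s(1), of "d i" "\<bar>x - y\<bar>"] d0[of i] unfolding wd
    by force
  define T where "T i = min (w i) c" for i
  have T0: "0 \<le> T i" for i
    using w0[of i] c0 by (simp add: T_def)
  have summT: "summable T"
    by (rule summable_comparison_test'[OF summ, of 0]) (use T0 in \<open>auto simp: T_def w0 c0 less_imp_le\<close>)
  \<comment> \<open>A candidate is heavy also for the truncated weights: either a single member already has
    truncated weight \<open>c\<close>, or truncation changes nothing.\<close>
  have truncated: "c \<le> load U T (J k)" if "k < K" for k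
  proof (cases "\<exists>i. U i \<inter> J k \<noteq> {} \<and> c \<le> w i")
    case True
    then obtain i where i: "U i \<inter> J k \<noteq> {}" "c \<le> w i"
      by blast
    then show ?thesis
      using weight_le_load[OF summT T0, where U = U, OF i(1)] i(2) T_def[of i] by linarith
  next
    case False
    then have "load U T (J k) = load U w (J k)"
      unfolding load_def T_def by (intro suminf_cong) force
    then show ?thesis
      using heavy[OF that] by simp
  qed
  have count: "real (card {k \<in> {..<K}. U i \<inter> J k \<noteq> {}}) \<le> 1 + 2 * d i / \<delta>" for i
  proof (rule card_le_spread)
    show "real k - real j \<le> 2 * d i / \<delta>"
      if jk: "j \<in> {k \<in> {..<K}. U i \<inter> J k \<noteq> {}}" "k \<in> {k \<in> {..<K}. U i \<inter> J k \<noteq> {}}" "j < k" for j k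
    proof -
      obtain x y where xy: "x \<in> U i" "x \<in> J j" "y \<in> U i" "y \<in> J k"
        using jk by blast
      have "y - x \<le> d i"
        using dist_d[of y i x] xy by auto
      moreover have "p k - p j - r \<le> y - x"
        using xy by (auto simp: J_def)
      moreover have "2 * \<delta> * (real k - real j) - \<delta> \<le> p k - p j"
        using p(2)[of k] p(3)[of j] by (simp add: algebra_simps)
      moreover have "\<delta> * 1 \<le> \<delta> * (real k - real j)"
        using jk(3) \<delta>0 by (intro mult_left_mono) auto
      ultimately have "\<delta> * (real k - real j) \<le> 2 * d i"
        using r by linarith
      then show ?thesis
        using \<delta>0 by (simp add: field_simps)
    qed
  qed (use \<delta>0 d0[of i] in auto)
  define B where "B = 1 + c * 2 * \<rho> powr (1 - s) / \<delta>"
  have B0: "0 < B"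
    using c0 \<delta>0 unfolding B_def by (intro add_pos_nonneg) auto
  have summed: "(\<Sum>k<K. if U i \<inter> J k = {} then 0 else T i)
      \<le> B * (if U i \<inter> {a..a + \<rho>} = {} then 0 else w i)" for i
  proof (cases "U i \<inter> {a..a + \<rho>} = {}")
    case True
    then have "U i \<inter> J k = {}" if "k < K" for k
      using J_sub[OF that] by blast
    then show ?thesis
      using True by simp
  next
    case False
    \<comment> \<open>A set meeting the large interval has weight at most the load, hence \<open>d i < \<rho>\<close>.\<close>
    have "w i < \<rho> powr s"
      using weight_le_load[OF summ w0, where U = U, OF False] light \<rho>0 powr_gt_zero[of \<rho> s] by linarith
    then have "d i < \<rho>"
      unfolding wd using powr_mono2[of s \<rho> "d i"] s \<rho>0 by force
    then have "d i powr (1 - s) \<le> \<rho> powr (1 - s)"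
      using d0[of i] s by (intro powr_mono2) auto
    moreover have "d i = w i * d i powr (1 - s)"
      using d0[of i] unfolding wd by (simp flip: powr_add)
    ultimately have d_le: "d i \<le> w i * \<rho> powr (1 - s)"
      using w0[of i] by (metis mult_left_mono)
    have "(\<Sum>k<K. if U i \<inter> J k = {} then 0 else T i)
        = T i * real (card {k \<in> {..<K}. U i \<inter> J k \<noteq> {}})"
    proof -
      have "(\<Sum>k<K. if U i \<inter> J k = {} then 0 else T i)
          = (\<Sum>k\<in>{k \<in> {..<K}. U i \<inter> J k \<noteq> {}}. T i)"
        by (rule sum.mono_neutral_cong_right) auto
      then show ?thesis by simp
    qed
    also have "\<dots> \<le> T i * (1 + 2 * d i / \<delta>)"
      using count T0 by (rule mult_left_mono)
    also have "\<dots> = T i + T i * (2 * d i / \<delta>)"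
      by (simp add: algebra_simps)
    also have "\<dots> \<le> w i + c * (2 * (w i * \<rho> powr (1 - s)) / \<delta>)"
      using d_le \<delta>0 d0[of i] c0 T0[of i]
      by (intro add_mono mult_mono divide_right_mono) (auto simp: T_def less_imp_le)
    also have "\<dots> = B * w i"
      by (simp add: B_def algebra_simps)
    finally show ?thesis
      using False by simp
  qed
  have s1: "summable (\<lambda>i. if U i \<inter> J k = {} then 0 else T i)" for k
    by (rule summable_restrict[OF summT T0])
  have s2: "summable (\<lambda>i. if U i \<inter> {a..a + \<rho>} = {} then 0 else w i)"
    by (rule summable_restrict[OF summ w0])
  have "real K * c \<le> (\<Sum>k<K. load U T (J k))"
    using sum_mono[of "{..<K}" "\<lambda>_. c" "\<lambda>k. load U T (J k)"] truncated by simp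
  also have "\<dots> = (\<Sum>i. \<Sum>k<K. if U i \<inter> J k = {} then 0 else T i)"
    unfolding load_def by (rule suminf_sum[symmetric]) (rule s1)
  also have "\<dots> \<le> (\<Sum>i. B * (if U i \<inter> {a..a + \<rho>} = {} then 0 else w i))"
    by (intro suminf_le summed summable_sum s1 summable_mult s2)
  also have "\<dots> = B * load U w {a..a + \<rho>}"
    unfolding load_def by (rule suminf_mult[OF s2])
  also have "\<dots> < B * (\<rho> powr s / 16)"
    using light B0 by simp
  also have "\<dots> = \<rho> powr s / 16 + c * \<rho> / (8 * \<delta>)"
  proof -
    have "\<rho> powr (1 - s) * \<rho> powr s = \<rho>"
      using \<rho>0 by (simp flip: powr_add)
    then show ?thesis
      unfolding B_def using \<delta>0 by (simp add: field_simps)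
  qed
  finally have "real K * c < \<rho> powr s / 16 + c * \<rho> / (8 * \<delta>)" .
  moreover have "\<rho> / (4 * \<delta>) * c \<le> real K * c"
    using K_low c0 by (intro mult_right_mono) auto
  ultimately have "\<rho> / (4 * \<delta>) * c < \<rho> powr s / 16 + c * \<rho> / (8 * \<delta>)"
    by linarith
  then have "\<rho> * c < \<delta> * \<rho> powr s / 2"
    using \<delta>0 by (simp add: field_simps)
  then show False
    using fine unfolding c_def by simp
qed

text \<open>
  The ubiquity hypothesis says that, with \<open>r\<^bsup>s\<^esup> / \<delta>\<close> and \<open>1 / \<delta>\<close> as large as desired, every interval of
  length \<open>\<delta>\<close> contains the centre of an interval of length \<open>r\<close> inside \<open>A m\<close>. Iterating
  \<open>light_subinterval\<close> from \<open>[0, 1]\<close> produces intervals \<open>I\<^sub>m\<close> shrinking to a point of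
  \<open>\<Inter>m. A m\<close>. A member \<open>U i\<close> containing that point would meet all \<open>I\<^sub>m\<close>, so \<open>w i \<le> |I\<^sub>m|\<^bsup>s\<^esup> \<rightarrow> 0\<close>
  although \<open>w i > 0\<close>.
\<close>

lemma light_cover_misses_point:
  fixes U :: "nat \<Rightarrow> real set" and A :: "nat \<Rightarrow> real set"
  assumes s: "0 < s" "s < 1" and wpos: "\<And>i. 0 < w i" and summ: "summable w"
    and diam: "\<And>i x y. x \<in> U i \<Longrightarrow> y \<in> U i \<Longrightarrow> \<bar>x - y\<bar> powr s \<le> w i"
    and light: "suminf w < 1 / 16"
    and ubiq: "\<And>m M. 0 < M \<Longrightarrow> \<exists>r \<delta>. 0 < r \<and> r \<le> \<delta> / 2 \<and> M * \<delta> \<le> 1 \<and> M * \<delta> \<le> r powr s \<and>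
                 (\<forall>x. \<exists>p\<ge>x. p \<le> x + \<delta> \<and> {p - r/2..p + r/2} \<subseteq> A m)"
  shows "\<exists>y. (\<forall>m. y \<in> A m) \<and> (\<forall>i. y \<notin> U i)"
proof -
  have w0: "0 \<le> w i" for i
    using wpos[of i] by simp
  define I where "I z = {fst z..fst z + snd z}" for z :: "real \<times> real"
  define good where "good z \<longleftrightarrow> 0 < snd z \<and> load U w (I z) < snd z powr s / 16" for z
  have step: "\<exists>z'. good z' \<and> I z' \<subseteq> I z \<inter> A m \<and> snd z' \<le> snd z / 2" if "good z" for z m
  proof -
    define \<rho> where "\<rho> = snd z"
    have \<rho>0: "0 < \<rho>"
      using that by (simp add: good_def \<rho>_def)
    \<comment> \<open>The two summands yield the conditions \<open>4 \<delta> \<le> \<rho>\<close> and \<open>8 \<delta> \<rho>\<^bsup>s\<^esup> \<le> \<rho> r\<^bsup>s\<^esup>\<close> of the induction step.\<close>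
    define M where "M = 4 / \<rho> + 8 * \<rho> powr s / \<rho>"
    have M0: "0 < M"
      using \<rho>0 unfolding M_def by (intro add_pos_nonneg) auto
    obtain r \<delta> where r: "0 < r" "r \<le> \<delta> / 2" "M * \<delta> \<le> 1" "M * \<delta> \<le> r powr s"
        "\<And>x. \<exists>p\<ge>x. p \<le> x + \<delta> \<and> {p - r/2..p + r/2} \<subseteq> A m"
      using ubiq[OF M0, of m] by blast
    have \<delta>0: "0 < \<delta>"
      using r by linarith
    have "4 / \<rho> * \<delta> \<le> M * \<delta>" "8 * \<rho> powr s / \<rho> * \<delta> \<le> M * \<delta>"
      using \<delta>0 \<rho>0 unfolding M_def by (intro mult_right_mono; simp)+
    then have "4 / \<rho> * \<delta> \<le> 1" "8 * \<rho> powr s / \<rho> * \<delta> \<le> r powr s"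
      using r by linarith+
    then have \<delta>: "4 * \<delta> \<le> \<rho>" "8 * \<delta> * \<rho> powr s \<le> \<rho> * r powr s"
      using \<rho>0 by (simp_all add: field_simps)
    have "\<exists>p\<in>{p. {p - r/2..p + r/2} \<subseteq> A m}. {p - r/2..p + r/2} \<subseteq> {fst z..fst z + \<rho>} \<and>
            load U w {p - r/2..p + r/2} < r powr s / 16"
      using that r(5)
      by (intro light_subinterval[OF s wpos summ diam _ r(1,2) \<delta>]) (auto simp: good_def I_def \<rho>_def)
    then obtain p where p: "{p - r/2..p + r/2} \<subseteq> A m" "{p - r/2..p + r/2} \<subseteq> I z"
        "load U w {p - r/2..p + r/2} < r powr s / 16"
      by (auto simp: I_def \<rho>_def)
    have eq: "I (p - r/2, r) = {p - r/2..p + r/2}"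
      by (simp add: I_def)
    show ?thesis
      using p r(1,2) \<delta>(1) \<delta>0 by (intro exI[of _ "(p - r/2, r)"]) (auto simp: good_def eq \<rho>_def)
  qed
  have start: "good (0, 1)"
  proof -
    have "load U w (I (0, 1)) \<le> suminf w"
      unfolding load_def
      by (rule suminf_le[OF _ summable_restrict[OF summ w0] summ]) (use w0 in auto)
    then show ?thesis
      using light by (simp add: good_def)
  qed
  define next_ival where
    "next_ival z m = (SOME z'. good z' \<and> I z' \<subseteq> I z \<inter> A m \<and> snd z' \<le> snd z / 2)" for z m
  define Z where "Z = rec_nat (0, 1) (\<lambda>m z. next_ival z m)"
  have Z_rec: "Z 0 = (0, 1)" "Z (Suc m) = next_ival (Z m) m" for m
    by (simp_all add: Z_def)
  have next_good: "good (next_ival z m) \<and> I (next_ival z m) \<subseteq> I z \<inter> A m \<and>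
      snd (next_ival z m) \<le> snd z / 2" if "good z" for z m
    unfolding next_ival_def by (rule someI_ex[OF step[OF that]])
  have Z_good: "good (Z m)" for m
    by (induction m) (use start next_good in \<open>auto simp: Z_rec\<close>)
  have Z_sub: "I (Z (Suc m)) \<subseteq> I (Z m) \<inter> A m" for m
    using next_good[OF Z_good] by (simp add: Z_rec)
  have Z_len: "snd (Z m) \<le> (1/2) ^ m" for m
  proof (induction m)
    case (Suc m)
    have "snd (Z (Suc m)) \<le> snd (Z m) / 2"
      using next_good[OF Z_good] by (simp add: Z_rec)
    then show ?case
      using Suc by simp
  qed (simp add: Z_rec)
  have "\<Inter>(range (\<lambda>m. I (Z m))) \<noteq> {}"
  proof (rule compact_nest)
    show "I (Z n) \<subseteq> I (Z m)" if "m \<le> n" for m n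
      using lift_Suc_antimono_le[of "\<lambda>m. I (Z m)", OF _ that] Z_sub by blast
    show "I (Z n) \<noteq> {}" for n
      using Z_good[of n] by (auto simp: good_def I_def)
  qed (auto simp: I_def)
  then obtain y where y: "y \<in> I (Z m)" for m
    by blast
  have "y \<in> A m" for m
    using Z_sub[of m] y[of "Suc m"] by blast
  moreover have "y \<notin> U i" for i
  proof
    assume "y \<in> U i"
    then have "U i \<inter> I (Z m) \<noteq> {}" for m
      using y[of m] by blast
    then have "w i \<le> load U w (I (Z m))" for m
      using weight_le_load[OF summ w0, where U = U] by blast
    moreover have "load U w (I (Z m)) < ((1/2) ^ m) powr s" for m
      using Z_good[of m] powr_mono2[of s "snd (Z m)" "(1/2) ^ m"] Z_len[of m] s
        powr_ge_zero[of "snd (Z m)" s] unfolding good_def by linarith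
    moreover have "((1/2::real) ^ m) powr s = ((1/2) powr s) ^ m" for m
      by (simp add: powr_powr mult.commute flip: powr_realpow)
    ultimately have "w i \<le> ((1/2) powr s) ^ m" for m
      by (metis le_less_trans less_imp_le)
    moreover have "(\<lambda>m. ((1/2::real) powr s) ^ m) \<longlonglongrightarrow> 0"
      using s powr_less_mono2[of s "1/2" 1] by (intro LIMSEQ_power_zero) auto
    ultimately have "w i \<le> 0"
      by (intro LIMSEQ_le_const[of _ 0]) auto
    then show False
      using wpos[of i] by simp
  qed
  ultimately show ?thesis by blast
qed

lemma hausdorff_measure_ubiquitous_nonzero:
  fixes A :: "nat \<Rightarrow> real set"
  assumes s: "0 < s" "s < 1"
    and ubiq: "\<And>m M. 0 < M \<Longrightarrow> \<exists>r \<delta>. 0 < r \<and> r \<le> \<delta> / 2 \<and> M * \<delta> \<le> 1 \<and> M * \<delta> \<le> r powr s \<and>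
                 (\<forall>x. \<exists>p\<ge>x. p \<le> x + \<delta> \<and> {p - r/2..p + r/2} \<subseteq> A m)"
  shows "hausdorff_measure s (\<Inter>m. A m) \<noteq> 0"
proof
  assume "hausdorff_measure s (\<Inter>m. A m) = 0"
  then obtain U where U: "(\<Inter>m. A m) \<subseteq> (\<Union>i. U i)" "\<And>i. bounded (U i)"
      "(\<Sum>i. diam_powr s (U i)) < ennreal (1/32)"
    by (rule hausdorff_null_cover[where e = "ennreal (1/32)"]) auto
  define v where "v i = (if U i = {} then 0 else diameter (U i) powr s)" for i
  have v0: "0 \<le> v i" for i
    by (simp add: v_def)
  have "diam_powr s (U i) = ennreal (v i)" for i
    using s by (simp add: diam_powr_def v_def)
  then have v_sum: "(\<Sum>i. ennreal (v i)) < ennreal (1/32)"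
    using U(3) by simp
  then have v_summ: "summable v"
    by (intro summable_suminf_not_top v0) auto
  have v_light: "suminf v < 1/32"
    using v_sum v0 v_summ by (simp add: suminf_ennreal2 suminf_nonneg ennreal_less_iff)
  \<comment> \<open>Singletons have diameter zero; the geometric term makes all weights positive.\<close>
  define w where "w i = v i + (1/2) ^ Suc i / 32" for i
  have g: "(\<lambda>i. (1/2) ^ Suc i / 32) sums (1 / 32 :: real)"
    using sums_divide[OF power_half_series, of 32] by simp
  have w_sums: "w sums (suminf v + 1/32)"
    unfolding w_def by (intro sums_add summable_sums v_summ g)
  have "\<exists>y. (\<forall>m. y \<in> A m) \<and> (\<forall>i. y \<notin> U i)"
  proof (rule light_cover_misses_point[OF s, where w = w])
    show "0 < w i" for i
      using v0[of i] by (simp add: w_def add_nonneg_pos)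
    show "summable w"
      using w_sums by (rule sums_summable)
    show "suminf w < 1/16"
      using sums_unique[OF w_sums] v_light by simp
    show "\<bar>x - y\<bar> powr s \<le> w i" if "x \<in> U i" "y \<in> U i" for i x y
    proof -
      have "\<bar>x - y\<bar> powr s \<le> diameter (U i) powr s"
        using diameter_bounded_bound[OF U(2) that] s by (intro powr_mono2) (auto simp: dist_real_def)
      also have "\<dots> \<le> w i"
        using that by (auto simp: w_def v_def)
      finally show ?thesis .
    qed
  qed (rule ubiq)
  then show False
    using U(1) by blast
qed

section \<open>Null measure of the approximation set\<close>

lemma dist_int_le: "k \<in> \<int> \<Longrightarrow> dist_int x \<le> \<bar>x - k\<bar>"
  by (simp add: dist_int_def infdist_le flip: dist_real_def)

lemma dist_int_lessD:
  assumes "dist_int x < e"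
  obtains k :: int where "\<bar>x - of_int k\<bar> < e"
proof -
  have "\<exists>a\<in>\<int>. dist x a < e"
    using assms unfolding dist_int_def infdist_def
    using cINF_less_iff[of "\<int>" "dist x" e] Ints_0 by (auto intro!: bdd_belowI2[of _ 0] split: if_splits)
  then show thesis
    using that by (auto elim!: Ints_cases simp: dist_real_def)
qed

text \<open>
  For a point \<open>y\<close> of \<open>E_set \<phi> \<alpha>\<close>, the integers \<open>z\<close> for which \<open>frac (n \<alpha>) + z\<close> approximates \<open>y\<close> range
  over a finite set, so one of them serves infinitely many \<open>n\<close>. Thus \<open>E_set \<phi> \<alpha>\<close> is covered by
  countably many limsup sets of intervals, each of measure zero.
\<close>

lemma hausdorff_measure_E_set_eq_0:
  assumes "0 < s" and pos: "\<And>n. 0 < \<phi> n" and lim: "\<phi> \<longlonglongrightarrow> 0"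
    and summ: "summable (\<lambda>n. \<phi> n powr s)"
  shows "hausdorff_measure s (E_set \<phi> \<alpha>) = 0"
proof -
  define A where "A z = {y. infinite {n. \<bar>frac (real n * \<alpha>) + of_int z - y\<bar> < \<phi> n}}" for z :: int
  have null: "hausdorff_measure s (A z) = 0" for z
    unfolding A_def by (rule hausdorff_cantelli[OF assms(1) pos lim summ])
  have cover: "E_set \<phi> \<alpha> \<subseteq> (\<Union>z. A z)"
  proof
    fix y assume "y \<in> E_set \<phi> \<alpha>"
    then have inf: "infinite {n. 1 \<le> n \<and> dist_int (real n * \<alpha> - y) < \<phi> n}"
      by (simp add: E_set_def)
    have "eventually (\<lambda>n. \<phi> n < 1) sequentially"
      using order_tendstoD(2)[OF lim, of 1] by simp
    then obtain N where N: "\<phi> n < 1" if "N \<le> n" for n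
      unfolding eventually_sequentially by blast
    define Z where "Z = {\<lfloor>y\<rfloor> - 2..\<lfloor>y\<rfloor> + 2}"
    have "{n. 1 \<le> n \<and> dist_int (real n * \<alpha> - y) < \<phi> n}
        \<subseteq> {..<N} \<union> (\<Union>z\<in>Z. {n. \<bar>frac (real n * \<alpha>) + of_int z - y\<bar> < \<phi> n})"
    proof (rule subsetI, rule UnCI)
      fix n
      assume n: "n \<in> {n. 1 \<le> n \<and> dist_int (real n * \<alpha> - y) < \<phi> n}" "n \<notin> (\<Union>z\<in>Z. {n. \<bar>frac (real n * \<alpha>) + of_int z - y\<bar> < \<phi> n})"
      obtain k :: int where k: "\<bar>real n * \<alpha> - y - of_int k\<bar> < \<phi> n"
        using n(1) by (auto elim: dist_int_lessD)
      define z where "z = \<lfloor>real n * \<alpha>\<rfloor> - k"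
      have z: "\<bar>frac (real n * \<alpha>) + of_int z - y\<bar> < \<phi> n"
        using k by (simp add: z_def frac_def algebra_simps)
      show "n \<in> {..<N}"
      proof (rule ccontr)
        assume "n \<notin> {..<N}"
        then have "\<phi> n < 1"
          using N by simp
        then have "\<bar>of_int z - y\<bar> < 2"
          using z frac_ge_0[of "real n * \<alpha>"] frac_lt_1[of "real n * \<alpha>"] by linarith
        then have "z \<in> Z"
          unfolding Z_def atLeastAtMost_iff by linarith
        then show False
          using z n(2) by blast
      qed
    qed
    then have "\<not> finite ({..<N} \<union> (\<Union>z\<in>Z. {n. \<bar>frac (real n * \<alpha>) + of_int z - y\<bar> < \<phi> n}))"
      using inf finite_subset by blast
    then obtain z where "infinite {n. \<bar>frac (real n * \<alpha>) + of_int z - y\<bar> < \<phi> n}"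
      by (auto simp: Z_def)
    then show "y \<in> (\<Union>z. A z)"
      by (auto simp: A_def)
  qed
  have "(\<Union>z. A z) = (\<Union>j. A (from_nat j))"
    by (metis (no_types) UNIV_I from_nat_to_nat image_image surj_def surj_from_nat)
  then have "hausdorff_measure s (\<Union>z. A z) = 0"
    using hausdorff_measure_Union_eq_0[of s "\<lambda>j. A (from_nat j)"] null by simp
  moreover have "hausdorff_measure s (E_set \<phi> \<alpha>) \<le> hausdorff_measure s (\<Union>z. A z)"
    unfolding hausdorff_measure_def hausdorff_premeasure_def
    by (intro SUP_mono' INF_superset_mono) (use cover in auto)
  ultimately show ?thesis by simp
qed

section \<open>Approximation by multiples of a number of finite type\<close>

text \<open>
  For \<open>\<theta>\<close> exceeding the type, the lower limit of \<open>n\<^bsup>\<theta>\<^esup> \<parallel>n \<alpha>\<parallel>\<close> is positive, which gives the bound for large \<open>n\<close>; for the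
  remaining \<open>n\<close> irrationality makes the distances positive.
\<close>

lemma finite_dioph_type_bound:
  assumes "\<alpha> \<notin> \<rat>" "dioph_type \<alpha> < \<infinity>"
  obtains \<theta> c :: real where "1 \<le> \<theta>" "0 < c"
    "\<And>n. 1 \<le> n \<Longrightarrow> c \<le> real n powr \<theta> * dist_int (real n * \<alpha>)"
proof -
  obtain t :: nat where t: "dioph_type \<alpha> < ereal (real t)"
    using less_PInf_Ex_of_nat[of "dioph_type \<alpha>"] assms(2) by auto
  define \<theta> where "\<theta> = max 1 (real t)"
  have \<theta>1: "1 \<le> \<theta>"
    by (simp add: \<theta>_def)
  define f where "f n = real n powr \<theta> * dist_int (real n * \<alpha>)" for n
  have f_pos: "0 < f n" if "1 \<le> n" for n
  proof -
    have "real n * \<alpha> \<notin> \<int>"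
    proof
      assume "real n * \<alpha> \<in> \<int>"
      then have "real n * \<alpha> / real n \<in> \<rat>"
        using Ints_subset_Rats by (intro Rats_divide) auto
      then show False
        using assms(1) that by simp
    qed
    then have "0 < dist_int (real n * \<alpha>)"
      unfolding dist_int_def by (intro infdist_pos_not_in_closed) (use Ints_0 in auto)
    then show ?thesis
      using that by (simp add: f_def)
  qed
  have "liminf (\<lambda>n. ereal (f n)) \<noteq> 0"
  proof
    assume "liminf (\<lambda>n. ereal (f n)) = 0"
    then have "ereal \<theta> \<le> dioph_type \<alpha>"
      unfolding dioph_type_def f_def using \<theta>1 by (intro Sup_upper) auto
    also have "\<dots> < ereal \<theta>"
      by (rule less_le_trans[OF t]) (simp add: \<theta>_def)
    finally show False by simp
  qed
  moreover have "0 \<le> liminf (\<lambda>n. ereal (f n))"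
    by (intro Liminf_bounded) (auto simp: f_def dist_int_def infdist_nonneg)
  ultimately have "0 < liminf (\<lambda>n. ereal (f n))"
    by simp
  then obtain c0 where c0: "0 < ereal c0" "ereal c0 < liminf (\<lambda>n. ereal (f n))"
    using ereal_dense2 by blast
  obtain N where N: "c0 < f n" if "N \<le> n" for n
    using less_LiminfD[OF c0(2)] unfolding eventually_sequentially by auto
  define c where "c = Min (insert c0 (f ` {1..N}))"
  have "0 < c"
    using c0(1) f_pos by (simp add: c_def)
  moreover have "c \<le> f n" if "1 \<le> n" for n
  proof (cases "N \<le> n")
    case True
    have "c \<le> c0"
      by (simp add: c_def)
    then show ?thesis
      using N[OF True] by simp
  next
    case False
    then show ?thesis
      using that unfolding c_def by (intro Min_le) auto
  qed
  ultimately show thesis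
    using that[OF \<theta>1] by (simp add: f_def)
qed

lemma large_approximation_denominator:
  fixes N :: nat
  assumes c: "\<And>n. 1 \<le> n \<Longrightarrow> c \<le> real n powr \<theta> * dist_int (real n * \<alpha>)" and N: "0 < N"
  obtains q :: nat and h :: int where "0 < q" "q \<le> N" "coprime h (int q)"
    "\<bar>real q * \<alpha> - of_int h\<bar> < 1 / real q" "c * real N < real q powr \<theta>"
proof -
  obtain h k where hk: "coprime h k" "0 < k" "k \<le> int N" "\<bar>of_int k * \<alpha> - of_int h\<bar> < 1 / N"
    using Dirichlet_approx_coprime[OF N] .
  define q where "q = nat k"
  have kq: "k = int q"
    using hk(2) by (simp add: q_def)
  have q: "0 < q" "q \<le> N"
    using hk(2,3) by (auto simp: kq)
  have approx: "\<bar>real q * \<alpha> - of_int h\<bar> < 1 / N"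
    using hk(4) by (simp add: kq)
  have "c \<le> real q powr \<theta> * dist_int (real q * \<alpha>)"
    using c q by simp
  also have "\<dots> \<le> real q powr \<theta> * \<bar>real q * \<alpha> - of_int h\<bar>"
    by (intro mult_left_mono dist_int_le) auto
  also have "\<dots> < real q powr \<theta> * (1 / N)"
    using approx q by (intro mult_strict_left_mono) auto
  finally have "c * real N < real q powr \<theta>"
    using N by (simp add: field_simps)
  moreover have "1 / real N \<le> 1 / real q"
    using q by (simp add: frac_le)
  ultimately show thesis
    using that[OF q] hk(1) approx kq by auto
qed

text \<open>
  For \<open>n = q + i\<close> with \<open>0 \<le> i < q\<close>, the number \<open>n \<alpha>\<close> differs from \<open>q \<alpha> + i h / q\<close> by less than
  \<open>1 / q\<close>, and \<open>i h\<close> runs through all residues modulo \<open>q\<close>.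
\<close>

lemma multiples_dense:
  assumes q: "0 < q" and cop: "coprime h (int q)"
    and approx: "\<bar>real q * \<alpha> - of_int h\<bar> < 1 / real q"
  obtains n :: nat and z :: int where "q \<le> n" "n < 2 * q"
    "x \<le> real n * \<alpha> + of_int z" "real n * \<alpha> + of_int z \<le> x + 3 / real q"
proof -
  \<comment> \<open>The grid point \<open>q \<alpha> + t / q\<close> lies in \<open>[x + 1 / q, x + 2 / q]\<close>, leaving room for the error \<open>1 / q\<close>.\<close>
  define t where "t = \<lceil>real q * (x + 1 / q - real q * \<alpha>)\<rceil>"
  have t: "real q * (x + 1 / q - real q * \<alpha>) \<le> of_int t"
      "of_int t \<le> real q * (x + 1 / q - real q * \<alpha>) + 1"
    unfolding t_def by linarith+
  have t_low: "x + 1 / q \<le> real q * \<alpha> + of_int t / real q"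
    using t(1) q by (simp add: field_simps)
  have t_up: "real q * \<alpha> + of_int t / real q \<le> x + 2 / q"
    using t(2) q by (simp add: field_simps)
  obtain v w where vw: "v * h + w * int q = 1"
    using bezout_int[of h "int q"] cop by auto
  define i where "i = nat ((v * t) mod int q)"
  have i: "int i = (v * t) mod int q" "i < q"
    using q by (auto simp: i_def nat_less_iff)
  define z where "z = w * t + h * ((v * t) div int q)"
  have "t = (v * h + w * int q) * t"
    using vw by simp
  also have "\<dots> = (v * t) * h + w * t * int q"
    by (simp add: algebra_simps)
  also have "v * t = int i + int q * ((v * t) div int q)"
    using i(1) by simp
  also have "(int i + int q * ((v * t) div int q)) * h + w * t * int q = int i * h + int q * z"
    by (simp add: z_def algebra_simps)
  finally have t_eq: "real_of_int t = real i * of_int h + real q * of_int z"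
    by (metis of_int_add of_int_mult of_int_of_nat_eq)
  have "\<bar>real i * \<alpha> + of_int z - of_int t / real q\<bar> = real i / real q * \<bar>real q * \<alpha> - of_int h\<bar>"
  proof -
    have "real i * \<alpha> + of_int z - of_int t / real q = real i / real q * (real q * \<alpha> - of_int h)"
      using q by (simp add: t_eq field_simps)
    then show ?thesis
      by (simp add: abs_mult)
  qed
  also have "\<dots> \<le> 1 * \<bar>real q * \<alpha> - of_int h\<bar>"
    using i(2) q by (intro mult_right_mono) auto
  finally have "\<bar>real i * \<alpha> + of_int z - of_int t / real q\<bar> < 1 / q"
    using approx by simp
  then have "x \<le> real (q + i) * \<alpha> + of_int z" "real (q + i) * \<alpha> + of_int z \<le> x + 3 / q"
    using t_low t_up by (simp_all add: algebra_simps add_divide_distrib[symmetric] abs_less_iff) argo+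
  then show thesis
    using that[of "q + i" z] i(2) by simp
qed

section \<open>The staircase\<close>

text \<open>
  The abscissa \<open>b\<^sub>k\<close> at which the \<open>k\<close>-th horizontal step of the staircase ends; it is also the height
  of that step. The squared factorial grows fast enough that \<open>b\<^sub>k\<^sub>+\<^sub>1 / b\<^sub>k = (k + 3)\<^sup>2\<close>.
\<close>

definition step_end :: "nat \<Rightarrow> real" where
  "step_end k = (fact (k + 2))\<^sup>2"

text \<open>
  The abscissa \<open>a\<^sub>k\<close> at which the \<open>k\<close>-th step begins. The ratio \<open>a\<^sub>k / b\<^sub>k\<close> tends to \<open>\<kappa>\<close>; bounding it below
  by \<open>1 / (k + 2)\<close> ensures \<open>a\<^sub>k\<^sub>+\<^sub>1 \<ge> (k + 3) b\<^sub>k\<close> even when \<open>\<kappa> = 0\<close>.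
\<close>

definition step_start :: "real \<Rightarrow> nat \<Rightarrow> real" where
  "step_start \<kappa> k = max \<kappa> (1 / real (k + 2)) * step_end k"

text \<open>
  The staircase \<open>G\<close>: the larger of \<open>x\<close> and the heights of the steps that begin before \<open>x\<close>. Only
  finitely many steps do, so the supremum is a maximum; written in this way, \<open>G\<close> is plainly monotone.
\<close>

definition staircase :: "real \<Rightarrow> real \<Rightarrow> real" where
  "staircase \<kappa> x = Sup (insert x (step_end ` {k. step_start \<kappa> k < x}))"

lemma step_end_Suc: "step_end (Suc k) = (real k + 3)\<^sup>2 * step_end k"
  by (simp add: step_end_def power2_eq_square algebra_simps)

lemma step_end_ge: "(real k + 2)\<^sup>2 \<le> step_end k"
proof -
  have "real (k + 2) \<le> fact (k + 2)"
    using fact_ge_self[of "k + 2"] by (metis of_nat_fact of_nat_le_iff)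
  then have "(real (k + 2))\<^sup>2 \<le> (fact (k + 2))\<^sup>2"
    by (rule power_mono) simp
  then show ?thesis
    unfolding step_end_def by (simp only: of_nat_add of_nat_numeral)
qed

lemma step_end_ge': "real k + 1 \<le> step_end k"
  using step_end_ge[of k] self_le_power[of "real k + 2" 2] by simp

lemma step_end_pos: "0 < step_end k"
  by (simp add: step_end_def)

lemma step_end_mono: "j \<le> k \<Longrightarrow> step_end j \<le> step_end k"
proof (rule lift_Suc_mono_le[of step_end])
  fix n
  show "step_end n \<le> step_end (Suc n)"
    unfolding step_end_Suc using step_end_pos[of n] by (simp add: power2_eq_square mult_le_cancel_right1)
      (smt (verit) mult_less_cancel_left2 of_nat_0_le_iff)
qed

lemma step_start_ge: "real k + 2 \<le> step_start \<kappa> k"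
proof -
  have "real k + 2 = 1 / real (k + 2) * (real k + 2)\<^sup>2"
    by (simp add: power2_eq_square field_simps)
  also have "\<dots> \<le> step_start \<kappa> k"
    unfolding step_start_def using step_end_ge by (intro mult_mono) (auto simp: le_max_iff_disj)
  finally show ?thesis .
qed

lemma step_start_Suc_ge: "(real k + 3) * step_end k \<le> step_start \<kappa> (Suc k)"
proof -
  have "(real k + 3) * step_end k = 1 / real (Suc k + 2) * step_end (Suc k)"
    by (simp add: step_end_Suc power2_eq_square field_simps)
  also have "\<dots> \<le> step_start \<kappa> (Suc k)"
    unfolding step_start_def using step_end_pos[of "Suc k"] by (intro mult_right_mono) auto
  finally show ?thesis .
qed

context
  fixes \<kappa> :: real
  assumes \<kappa>: "0 \<le> \<kappa>" "\<kappa> < 1"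
begin

lemma step_start_less_end: "step_start \<kappa> k < step_end k"
proof -
  have "max \<kappa> (1 / real (k + 2)) < 1"
    using \<kappa> by simp
  then show ?thesis
    unfolding step_start_def using step_end_pos[of k] by (simp add: mult_less_cancel_right2)
qed

lemma step_start_mono: 
  assumes "j \<le> k" shows "step_start \<kappa> j \<le> step_start \<kappa> k"
proof (rule lift_Suc_mono_le[OF _ assms])
  fix n
  have "1 * step_end n \<le> (real n + 3) * step_end n"
    using step_end_pos[of n] by (intro mult_right_mono) auto
  then show "step_start \<kappa> n \<le> step_start \<kappa> (Suc n)"
    using step_start_less_end[of n] step_start_Suc_ge[of n \<kappa>] by linarith
qed

lemma finite_steps: "finite {k. step_start \<kappa> k < x}"
proof (rule finite_subset)
  show "{k. step_start \<kappa> k < x} \<subseteq> {..nat \<lceil>x\<rceil>}"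
  proof
    fix k assume "k \<in> {k. step_start \<kappa> k < x}"
    then have "real k \<le> x"
      using step_start_ge[of k \<kappa>] by simp
    then show "k \<in> {..nat \<lceil>x\<rceil>}"
      by (simp add: le_nat_iff) linarith
  qed
qed simp

lemma staircase_ge: "x \<le> staircase \<kappa> x"
  and staircase_ge_end: "step_start \<kappa> k < x \<Longrightarrow> step_end k \<le> staircase \<kappa> x"
  unfolding staircase_def using finite_steps[of x]
  by (auto intro!: cSup_upper)

lemma staircase_leI:
  assumes "x \<le> y" "\<And>k. step_start \<kappa> k < x \<Longrightarrow> step_end k \<le> y"
  shows "staircase \<kappa> x \<le> y"
  unfolding staircase_def using assms by (intro cSup_least) auto

lemma staircase_mono:
  assumes "x \<le> y"
  shows "staircase \<kappa> x \<le> staircase \<kappa> y"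
proof (rule staircase_leI)
  show "x \<le> staircase \<kappa> y"
    using assms staircase_ge[of y] by simp
  show "step_end k \<le> staircase \<kappa> y" if "step_start \<kappa> k < x" for k
    using that assms by (intro staircase_ge_end) simp
qed

lemma staircase_eq:
  assumes "step_end k \<le> x" "x \<le> step_start \<kappa> (Suc k)"
  shows "staircase \<kappa> x = x"
proof (rule antisym[OF staircase_leI staircase_ge])
  fix j assume "step_start \<kappa> j < x"
  then have "\<not> Suc k \<le> j"
    using assms(2) step_start_mono[of "Suc k" j] by linarith
  then show "step_end j \<le> x"
    using assms(1) step_end_mono[of j k] by simp
qed simp

lemma mult_staircase_le:
  assumes "0 \<le> x"
  shows "\<kappa> * staircase \<kappa> x \<le> x"
proof (cases "\<kappa> = 0")
  case False
  then have pos: "0 < \<kappa>"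
    using \<kappa> by simp
  have "staircase \<kappa> x \<le> x / \<kappa>"
  proof (rule staircase_leI)
    show "x \<le> x / \<kappa>"
      using pos \<kappa> assms by (simp add: field_simps mult_left_le_one_le mult_left_le)
    fix k assume k: "step_start \<kappa> k < x"
    have "\<kappa> * step_end k \<le> step_start \<kappa> k"
      unfolding step_start_def using step_end_pos[of k] by (intro mult_right_mono) auto
    then show "step_end k \<le> x / \<kappa>"
      using k pos by (simp add: field_simps)
  qed
  then show ?thesis
    using pos by (simp add: field_simps)
qed (use assms in simp)

end

section \<open>The approximation function\<close>

text \<open>
  The approximation function \<open>\<phi>\<close>, in logarithmic coordinates the reflected and rescaled staircase. It
  equals \<open>n\<^bsup>-1/u\<^esup>\<close> where the staircase is the identity and is constant along each step.
\<close>

definition staircase_fun :: "real \<Rightarrow> real \<Rightarrow> nat \<Rightarrow> real" where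
  "staircase_fun \<kappa> u n = exp (- staircase \<kappa> (ln (real n)) / u)"

lemma staircase_fun_pos: "0 < staircase_fun \<kappa> u n"
  by (simp add: staircase_fun_def)

context
  fixes \<kappa> u :: real
  assumes \<kappa>: "0 \<le> \<kappa>" "\<kappa> < 1" and u: "0 < u" "u \<le> 1"
begin

lemma staircase_fun_antimono: "antimono_on {1..} (staircase_fun \<kappa> u)"
proof (rule monotone_onI)
  fix m n :: nat assume "m \<in> {1..}" "n \<in> {1..}" "m \<le> n"
  then have "staircase \<kappa> (ln (real m)) \<le> staircase \<kappa> (ln (real n))"
    by (intro staircase_mono[OF \<kappa>]) auto
  then show "staircase_fun \<kappa> u n \<le> staircase_fun \<kappa> u m"
    using u by (simp add: staircase_fun_def divide_right_mono)
qed

lemma staircase_fun_le: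
  assumes "1 \<le> n"
  shows "staircase_fun \<kappa> u n \<le> real n powr (- 1 / u)"
proof -
  have "real n powr (- 1 / u) = exp (- ln (real n) / u)"
    using assms by (simp add: powr_def)
  then show ?thesis
    using staircase_ge[OF \<kappa>, of "ln (real n)"] u by (simp add: staircase_fun_def divide_right_mono)
qed

lemma staircase_fun_tendsto: "staircase_fun \<kappa> u \<longlonglongrightarrow> 0"
proof (rule tendsto_sandwich[OF _ _ tendsto_const])
  show "\<forall>\<^sub>F n in sequentially. 0 \<le> staircase_fun \<kappa> u n"
    by (simp add: staircase_fun_def)
  show "\<forall>\<^sub>F n in sequentially. staircase_fun \<kappa> u n \<le> real n powr (- 1 / u)"
    using eventually_ge_at_top[of 1] by eventually_elim (rule staircase_fun_le)
  show "(\<lambda>n. real n powr (- 1 / u)) \<longlonglongrightarrow> 0"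
    using u by (intro tendsto_neg_powr filterlim_real_sequentially) auto
qed

lemma staircase_fun_summable:
  assumes "u < s"
  shows "summable (\<lambda>n. staircase_fun \<kappa> u n powr s)"
proof (rule summable_comparison_test'[where N = 1])
  have "1 < s / u"
    using assms u by simp
  then show "summable (\<lambda>n. real n powr (- s / u))"
    by (simp add: summable_real_powr_iff)
  fix n :: nat assume n: "1 \<le> n"
  have "staircase_fun \<kappa> u n powr s \<le> (real n powr (- 1 / u)) powr s"
    using staircase_fun_le[OF n] assms u staircase_fun_pos[of \<kappa> u n] by (intro powr_mono2) auto
  then show "norm (staircase_fun \<kappa> u n powr s) \<le> real n powr (- s / u)"
    by (simp add: powr_powr)
qed

lemma staircase_fun_quotient:
  "ln (real n) / - ln (staircase_fun \<kappa> u n) = u * (ln (real n) / staircase \<kappa> (ln (real n)))"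
  using u by (simp add: staircase_fun_def)

lemma upper_order_staircase_fun: "upper_order (staircase_fun \<kappa> u) = ereal u"
proof (rule antisym)
  have "\<forall>\<^sub>F n in sequentially. ereal (ln (real n) / - ln (staircase_fun \<kappa> u n)) \<le> ereal u"
    using eventually_ge_at_top[of 2]
  proof eventually_elim
    case (elim n)
    then have "0 < ln (real n)"
      by simp
    then have "ln (real n) / staircase \<kappa> (ln (real n)) \<le> 1"
      using staircase_ge[OF \<kappa>, of "ln (real n)"] by simp
    then have "u * (ln (real n) / staircase \<kappa> (ln (real n))) \<le> u * 1"
      using u by (intro mult_left_mono) auto
    then show ?case
      unfolding staircase_fun_quotient by simp
  qed
  then show "upper_order (staircase_fun \<kappa> u) \<le> ereal u"
    unfolding upper_order_def by (rule Limsup_bounded)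
  have "\<exists>m\<ge>n. ereal u \<le> ereal (ln (real m) / - ln (staircase_fun \<kappa> u m))" for n
  proof -
    \<comment> \<open>The first integer not below \<open>exp b\<^sub>n\<close>, where the staircase is the identity.\<close>
    define m where "m = nat \<lceil>exp (step_end n)\<rceil>"
    have one: "1 \<le> step_end n"
      using step_end_ge'[of n] by simp
    have "real m = of_int \<lceil>exp (step_end n)\<rceil>"
      using exp_gt_zero[of "step_end n"] unfolding m_def by (intro of_nat_nat) linarith
    then have m: "exp (step_end n) \<le> real m" "real m \<le> exp (step_end n) + 1"
      by linarith+
    have big: "step_end n + 1 \<le> exp (step_end n)"
      using exp_ge_add_one_self[of "step_end n"] by linarith
    have "ln (real m) \<le> ln (exp 1 * exp (step_end n))"
    proof (subst ln_le_cancel_iff)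
      have "2 * exp (step_end n) \<le> exp 1 * exp (step_end n)"
        using exp_ge_add_one_self[of 1] by (intro mult_right_mono) auto
      then show "real m \<le> exp 1 * exp (step_end n)"
        using m(2) big one by linarith
    qed (use m(1) exp_gt_zero[of "step_end n"] in linarith, simp)
    then have "ln (real m) \<le> 1 + step_end n"
      by (simp add: ln_mult)
    also have "\<dots> \<le> 3 * step_end n"
      using one by simp
    also have "\<dots> \<le> (real n + 3) * step_end n"
      using one by (intro mult_right_mono) auto
    also have "\<dots> \<le> step_start \<kappa> (Suc n)"
      by (rule step_start_Suc_ge)
    finally have up: "ln (real m) \<le> step_start \<kappa> (Suc n)" .
    have low: "step_end n \<le> ln (real m)"
      using m(1) by (meson exp_gt_zero ln_ge_iff less_le_trans)
    have "staircase \<kappa> (ln (real m)) = ln (real m)"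
      by (rule staircase_eq[OF \<kappa> low up])
    moreover have "real n \<le> real m"
      using m(1) big step_end_ge'[of n] by linarith
    ultimately show ?thesis
      unfolding staircase_fun_quotient using low one by (intro exI[of _ m]) auto
  qed
  then show "ereal u \<le> upper_order (staircase_fun \<kappa> u)"
    unfolding upper_order_def limsup_INF_SUP by (intro INF_greatest) (meson SUP_upper2 atLeast_iff)
qed

lemma lower_order_staircase_fun: "lower_order (staircase_fun \<kappa> u) = ereal (\<kappa> * u)"
proof (rule antisym)
  have "\<forall>\<^sub>F n in sequentially. ereal (\<kappa> * u) \<le> ereal (ln (real n) / - ln (staircase_fun \<kappa> u n))"
    using eventually_ge_at_top[of 2]
  proof eventually_elim
    case (elim n)
    then have pos: "0 < ln (real n)"
      by simp
    then have "0 < staircase \<kappa> (ln (real n))"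
      using staircase_ge[OF \<kappa>, of "ln (real n)"] by linarith
    then have "\<kappa> \<le> ln (real n) / staircase \<kappa> (ln (real n))"
      using mult_staircase_le[OF \<kappa>, of "ln (real n)"] pos by (simp add: field_simps)
    then have "u * \<kappa> \<le> u * (ln (real n) / staircase \<kappa> (ln (real n)))"
      using u by (intro mult_left_mono) auto
    then show ?case
      unfolding staircase_fun_quotient by (simp add: mult.commute)
  qed
  then show "ereal (\<kappa> * u) \<le> lower_order (staircase_fun \<kappa> u)"
    unfolding lower_order_def by (rule Liminf_bounded)
  have approx: "\<exists>m\<ge>n. ereal (ln (real m) / - ln (staircase_fun \<kappa> u m)) \<le> ereal (\<kappa> * u + 2 / (real n + 1))" for n
  proof -
    \<comment> \<open>The first integer after \<open>exp a\<^sub>n\<close>, where the staircase has just jumped to \<open>b\<^sub>n\<close>.\<close>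
    define m where "m = nat (\<lfloor>exp (step_start \<kappa> n)\<rfloor> + 1)"
    have start: "real n + 2 \<le> step_start \<kappa> n"
      by (rule step_start_ge)
    have m: "exp (step_start \<kappa> n) < real m" "real m \<le> exp (step_start \<kappa> n) + 1"
      unfolding m_def using exp_gt_zero[of "step_start \<kappa> n"] by linarith+
    have big: "step_start \<kappa> n + 1 \<le> exp (step_start \<kappa> n)"
      using exp_ge_add_one_self[of "step_start \<kappa> n"] by linarith
    have "ln (real m) \<le> ln (exp 1 * exp (step_start \<kappa> n))"
    proof (subst ln_le_cancel_iff)
      have "2 * exp (step_start \<kappa> n) \<le> exp 1 * exp (step_start \<kappa> n)"
        using exp_ge_add_one_self[of 1] by (intro mult_right_mono) auto
      then show "real m \<le> exp 1 * exp (step_start \<kappa> n)"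
        using m(2) big start by linarith
    qed (use m(1) exp_gt_zero[of "step_start \<kappa> n"] in linarith, simp)
    then have up: "ln (real m) \<le> 1 + step_start \<kappa> n"
      by (simp add: ln_mult)
    have low: "step_start \<kappa> n < ln (real m)"
      using m(1) by (metis exp_gt_zero exp_less_cancel_iff exp_ln less_trans)
    have e: "0 < step_end n" "real n + 1 \<le> step_end n"
      by (rule step_end_pos, rule step_end_ge')
    have "ln (real m) / staircase \<kappa> (ln (real m)) \<le> (1 + step_start \<kappa> n) / step_end n"
      using up staircase_ge_end[OF \<kappa> low] e low start by (intro frac_le) auto
    also have "\<dots> = 1 / step_end n + max \<kappa> (1 / real (n + 2))"
      using e by (simp add: step_start_def field_simps)
    also have "\<dots> \<le> 1 / (real n + 1) + (\<kappa> + 1 / (real n + 1))"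
    proof (rule add_mono)
      show "1 / step_end n \<le> 1 / (real n + 1)"
        using e by (intro frac_le) auto
      have "1 / real (n + 2) \<le> 1 / (real n + 1)"
        by (intro frac_le) auto
      moreover have "0 \<le> 1 / (real n + 1)"
        by simp
      ultimately show "max \<kappa> (1 / real (n + 2)) \<le> \<kappa> + 1 / (real n + 1)"
        using \<kappa>(1) by linarith
    qed
    finally have "ln (real m) / staircase \<kappa> (ln (real m)) \<le> \<kappa> + 2 / (real n + 1)"
      by simp
    then have "u * (ln (real m) / staircase \<kappa> (ln (real m))) \<le> u * (\<kappa> + 2 / (real n + 1))"
      using u by (intro mult_left_mono) auto
    also have "\<dots> \<le> \<kappa> * u + 1 * (2 / (real n + 1))"
      using u mult_right_mono[of u 1 "2 / (real n + 1)"] by (simp add: algebra_simps)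
    finally have "ln (real m) / - ln (staircase_fun \<kappa> u m) \<le> \<kappa> * u + 2 / (real n + 1)"
      unfolding staircase_fun_quotient by simp
    moreover have "real n \<le> real m"
      using m(1) big start by linarith
    ultimately show ?thesis
      by (intro exI[of _ m]) auto
  qed
  show "lower_order (staircase_fun \<kappa> u) \<le> ereal (\<kappa> * u)"
    unfolding lower_order_def liminf_SUP_INF
  proof (intro SUP_least)
    fix N :: nat
    show "(INF m\<in>{N..}. ereal (ln (real m) / - ln (staircase_fun \<kappa> u m))) \<le> ereal (\<kappa> * u)"
    proof (rule ereal_le_epsilon2)
      fix e :: real assume e: "0 < e"
      obtain k :: nat where k: "2 / e < real k"
        using reals_Archimedean2 by blast
      define n where "n = max N k"
      have "2 / e < real n + 1"
        using k by (simp add: n_def)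
      then have n_e: "2 / (real n + 1) \<le> e"
        using e by (simp add: field_simps)
      obtain m where m: "n \<le> m"
          "ereal (ln (real m) / - ln (staircase_fun \<kappa> u m)) \<le> ereal (\<kappa> * u + 2 / (real n + 1))"
        using approx by blast
      have "(INF m\<in>{N..}. ereal (ln (real m) / - ln (staircase_fun \<kappa> u m)))
          \<le> ereal (\<kappa> * u + 2 / (real n + 1))"
        using m(1) by (intro INF_lower2[of m] m(2)) (simp add: n_def)
      also have "\<dots> \<le> ereal (\<kappa> * u) + ereal e"
        using n_e by simp
      finally show "(INF m\<in>{N..}. ereal (ln (real m) / - ln (staircase_fun \<kappa> u m)))
          \<le> ereal (\<kappa> * u) + ereal e" .
    qed
  qed
qed

section \<open>Lower bound for the dimension\<close>

text \<open>
  Arbitrarily large \<open>q\<close> approximate \<open>\<alpha>\<close> as in Dirichlet's theorem while \<open>ln (2 q)\<close> lies where the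
  staircase is the identity. For \<open>N \<approx> exp a\<^sub>k\<^sub>+\<^sub>1 / 2\<close> one has \<open>q\<^bsup>\<theta>\<^esup> > c N\<close>, so
  \<open>\<theta> ln q \<ge> ln (c / 4) + (k + 3) b\<^sub>k \<ge> \<theta> b\<^sub>k\<close> as soon as \<open>k\<close> exceeds \<open>\<theta> + |ln (c / 4)|\<close>.
\<close>

lemma denominator_in_power_range:
  fixes Q :: real
  assumes "\<alpha> \<notin> \<rat>" "dioph_type \<alpha> < \<infinity>"
  obtains q :: nat and h :: int where "0 < q" "Q \<le> real q" "coprime h (int q)"
    "\<bar>real q * \<alpha> - of_int h\<bar> < 1 / real q" "staircase_fun \<kappa> u (2 * q) = real (2 * q) powr (- 1 / u)"
proof -
  obtain \<theta> c where \<theta>: "1 \<le> \<theta>" and c: "0 < c"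
      "\<And>n. 1 \<le> n \<Longrightarrow> c \<le> real n powr \<theta> * dist_int (real n * \<alpha>)"
    using finite_dioph_type_bound[OF assms] by blast
  obtain k :: nat where k: "max Q (\<theta> + \<bar>ln (c / 4)\<bar>) < real k"
    using reals_Archimedean2 by blast
  define b where "b = step_end k"
  define a where "a = step_start \<kappa> (Suc k)"
  have b: "real k + 1 \<le> b"
    unfolding b_def by (rule step_end_ge')
  have a: "(real k + 3) * b \<le> a" "3 \<le> a"
    unfolding a_def b_def using step_start_Suc_ge step_start_ge[of "Suc k" \<kappa>] by auto
  define N where "N = nat \<lfloor>exp a / 2\<rfloor>"
  have a4: "4 \<le> exp a"
    using exp_ge_add_one_self[of a] a(2) by linarith
  have N: "real N \<le> exp a / 2" "exp a / 2 - 1 < real N"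
    unfolding N_def using a4 by linarith+
  have N4: "exp a / 4 \<le> real N"
    using N(2) a4 by linarith
  have N0: "0 < N"
    using N4 a4 by (cases N) auto
  obtain q h where q: "0 < q" "q \<le> N" "coprime h (int q)"
      "\<bar>real q * \<alpha> - of_int h\<bar> < 1 / real q" "c * real N < real q powr \<theta>"
    using large_approximation_denominator[OF c(2) N0] by blast
  have "exp (\<theta> * b) \<le> real q powr \<theta>"
  proof -
    have "\<theta> * b + \<bar>ln (c / 4)\<bar> \<le> \<theta> * b + \<bar>ln (c / 4)\<bar> * b"
      using b by (intro add_left_mono) (simp add: mult_le_cancel_left1)
    also have "\<dots> = (\<theta> + \<bar>ln (c / 4)\<bar>) * b"
      by (simp add: algebra_simps)
    also have "\<dots> \<le> (real k + 3) * b"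
      using k b by (intro mult_right_mono) auto
    finally have "\<theta> * b \<le> ln (c / 4) + a"
      using a(1) by linarith
    then have "exp (\<theta> * b) \<le> exp (ln (c / 4) + a)"
      by simp
    also have "\<dots> = c * (exp a / 4)"
      using c(1) by (simp add: exp_add)
    also have "\<dots> \<le> c * real N"
      using N4 c(1) by simp
    finally show ?thesis
      using q(5) by simp
  qed
  then have "exp (\<theta> * b) \<le> exp (\<theta> * ln (real q))"
    using q(1) by (simp add: powr_def)
  then have b_le: "b \<le> ln (real q)"
    using \<theta> by simp
  have lnq: "ln (real q) \<le> ln (real (2 * q))"
    using q(1) by simp
  have "real (2 * q) \<le> exp a"
    using q(2) N(1) by simp
  then have "ln (real (2 * q)) \<le> a"
    using q(1) by (metis exp_gt_zero ln_exp ln_le_cancel_iff mult_pos_pos of_nat_0_less_iff zero_less_numeral)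
  then have "staircase \<kappa> (ln (real (2 * q))) = ln (real (2 * q))"
    using b_le lnq by (intro staircase_eq[OF \<kappa>, of k]) (auto simp: a_def b_def)
  then have "staircase_fun \<kappa> u (2 * q) = real (2 * q) powr (- 1 / u)"
    using q(1) by (simp add: staircase_fun_def powr_def)
  moreover have "Q \<le> real q"
    using k b b_le ln_le_minus_one[of "real q"] q(1) by simp
  ultimately show thesis
    using that q by blast
qed

lemma hausdorff_measure_E_set_nonzero:
  assumes \<alpha>: "\<alpha> \<notin> \<rat>" "dioph_type \<alpha> < \<infinity>" and s: "0 < s" "s < u"
  shows "hausdorff_measure s (E_set (staircase_fun \<kappa> u) \<alpha>) \<noteq> 0"
proof -
  let ?\<phi> = "staircase_fun \<kappa> u"
  define A where "A m = {y. \<exists>n\<ge>m. 1 \<le> n \<and> dist_int (real n * \<alpha> - y) < ?\<phi> n}" for m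
  have E: "E_set ?\<phi> \<alpha> = (\<Inter>m. A m)"
    unfolding E_set_def A_def by (auto simp: infinite_nat_iff_unbounded_le)
  have "hausdorff_measure s (\<Inter>m. A m) \<noteq> 0"
  proof (rule hausdorff_measure_ubiquitous_nonzero)
    fix m :: nat and M :: real assume M: "0 < M"
    have su: "0 < 1 - s / u"
      using s u by simp
    \<comment> \<open>The lower bounds on \<open>q\<close> give \<open>n \<ge> m\<close>, \<open>M \<delta> \<le> 1\<close> and \<open>M \<delta> \<le> r\<^bsup>s\<^esup>\<close>, in this order; the last
      uses \<open>r\<^bsup>s\<^esup> / \<delta> = (2 q)\<^bsup>1-s/u\<^esup> / 6\<close>.\<close>
    define Q where "Q = max (real m) (max (3 * M) ((6 * M) powr (1 / (1 - s / u))))"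
    obtain q h where q: "0 < q" "Q \<le> real q" "coprime h (int q)"
        "\<bar>real q * \<alpha> - of_int h\<bar> < 1 / real q" "?\<phi> (2 * q) = real (2 * q) powr (- 1 / u)"
      using denominator_in_power_range[OF \<alpha>] by blast
    define r where "r = real (2 * q) powr (- 1 / u)"
    define \<delta> where "\<delta> = 3 / real q"
    have r0: "0 < r"
      using q(1) by (simp add: r_def)
    have "r \<le> real (2 * q) powr (- 1)"
      unfolding r_def using q(1) u by (intro powr_mono) (auto simp: field_simps)
    also have "\<dots> \<le> \<delta> / 2"
      using q(1) by (simp add: \<delta>_def powr_minus divide_simps)
    finally have r\<delta>: "r \<le> \<delta> / 2" .
    have M1: "M * \<delta> \<le> 1"
      using q(1,2) by (simp add: \<delta>_def Q_def field_simps)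
    have Mr: "M * \<delta> \<le> r powr s"
    proof -
      have "6 * M = ((6 * M) powr (1 / (1 - s / u))) powr (1 - s / u)"
        using su M by (simp add: powr_powr del: divide_eq_1_iff) (use s in auto)
      also have "\<dots> \<le> real (2 * q) powr (1 - s / u)"
        using q(1,2) su by (intro powr_mono2) (auto simp: Q_def)
      also have "\<dots> = real (2 * q) * r powr s"
        using q(1) powr_add[of "real (2 * q)" 1 "- (s / u)"] by (simp add: r_def powr_powr)
      finally show ?thesis
        using q(1) by (simp add: \<delta>_def field_simps)
    qed
    have "\<exists>p\<ge>x. p \<le> x + \<delta> \<and> {p - r/2..p + r/2} \<subseteq> A m" for x
    proof -
      obtain n :: nat and z :: int where n: "q \<le> n" "n < 2 * q"
          "x \<le> real n * \<alpha> + of_int z" "real n * \<alpha> + of_int z \<le> x + 3 / real q"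
        using multiples_dense[OF q(1,3,4)] .
      have "?\<phi> (2 * q) \<le> ?\<phi> n"
        using staircase_fun_antimono n(1,2) q(1) unfolding monotone_on_def by simp
      then have "r \<le> ?\<phi> n"
        using q(5) by (simp add: r_def)
      have "y \<in> A m" if "y \<in> {real n * \<alpha> + of_int z - r/2..real n * \<alpha> + of_int z + r/2}" for y
      proof -
        have "dist_int (real n * \<alpha> - y) \<le> \<bar>real n * \<alpha> - y - (- of_int z)\<bar>"
          by (rule dist_int_le) simp
        also have "\<dots> \<le> r / 2"
          using that by (auto simp: abs_if)
        also have "\<dots> < ?\<phi> n"
          using \<open>r \<le> ?\<phi> n\<close> r0 by simp
        finally show ?thesis
          using n(1) q(1,2) unfolding A_def by (auto simp: Q_def intro!: exI[of _ n])
      qed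
      then show ?thesis
        using n(3,4) unfolding \<delta>_def by (intro exI[of _ "real n * \<alpha> + of_int z"]) auto
    qed
    then show "\<exists>r \<delta>. 0 < r \<and> r \<le> \<delta> / 2 \<and> M * \<delta> \<le> 1 \<and> M * \<delta> \<le> r powr s \<and>
        (\<forall>x. \<exists>p\<ge>x. p \<le> x + \<delta> \<and> {p - r/2..p + r/2} \<subseteq> A m)"
      using r0 r\<delta> M1 Mr by blast
  qed (use s u in auto)
  then show ?thesis
    by (simp add: E)
qed

end

theorem theorem1p6:
  fixes l u :: real
  assumes "0 \<le> l" and "l < u" and "u \<le> 1"
  shows "\<exists>\<phi> :: nat \<Rightarrow> real.
           (\<forall>n\<ge>1. 0 < \<phi> n) \<and> antimono_on {1..} \<phi> \<and> \<phi> \<longlonglongrightarrow> 0 \<and>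
           lower_order \<phi> = ereal l \<and> upper_order \<phi> = ereal u \<and>
           (\<forall>\<alpha> :: real. \<alpha> \<notin> \<rat> \<and> dioph_type \<alpha> < \<infinity> \<longrightarrow>
              hausdorff_dim (E_set \<phi> \<alpha>) = ereal u)"
proof -
  have u: "0 < u" "u \<le> 1"
    using assms by auto
  define \<kappa> where "\<kappa> = l / u"
  have \<kappa>: "0 \<le> \<kappa>" "\<kappa> < 1" and l: "\<kappa> * u = l"
    using assms u by (auto simp: \<kappa>_def)
  have "hausdorff_dim (E_set (staircase_fun \<kappa> u) \<alpha>) = ereal u"
    if "\<alpha> \<notin> \<rat>" "dioph_type \<alpha> < \<infinity>" for \<alpha>
  proof (rule hausdorff_dim_eqI[OF u(1)])
    show "hausdorff_measure s (E_set (staircase_fun \<kappa> u) \<alpha>) = 0" if "u < s" for s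
      using that u staircase_fun_pos[of \<kappa> u] staircase_fun_tendsto[OF \<kappa> u] staircase_fun_summable[OF \<kappa> u that]
      by (intro hausdorff_measure_E_set_eq_0) auto
  qed (rule hausdorff_measure_E_set_nonzero[OF \<kappa> u that])
  then show ?thesis
    using staircase_fun_pos[of \<kappa> u] staircase_fun_antimono[OF \<kappa> u] staircase_fun_tendsto[OF \<kappa> u]
      lower_order_staircase_fun[OF \<kappa> u] upper_order_staircase_fun[OF \<kappa> u] l
    by (intro exI[of _ "staircase_fun \<kappa> u"]) auto
qed

end
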